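(* Let $x_1,\dotsc,x_{m-1}$ be odd positive integers. Given a prime number $p$, let $V_p=\max_{i\in[m-1]}\{v_p(x_i)\}$, and for an odd positive integer $x_m$ let $y=\gcd(\sigma_{m-1}(x_1,\dotsc,x_m),x_1\dotsm x_m)$. The following statements are equivalent: (a) There exists an odd positive integer $x_m$ such that $v_p(y)=v_p(x_1\dotsm x_{m-1})-V_p$ for every prime number $p$ that divides $x_i$ for some $i\in[m-1]$. (b) There exists an odd positive integer $x_m$ such that $v_p(y)=v_p(x_1\dotsm x_{m-1})+V_p$ for every prime number $p$ that divides $x_i$ for some $i\in[m-1]$. (c) For every prime number $p$ that divides $x_i$ for some $i\in[m-1]$, we have that $p$ does not divide \[ \sum_{i=1}^{m-1}p^{V_p-v_p(x_i)}\prod_{\substack{1\leq j\leq m-1\\ j\neq i}}\frac{x_j}{p^{v_p(x_j)}}. \]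
   Context: Here $[m]=\{1,\dotsc,m\}$, $\sigma_{m-1}(x_1,\dotsc,x_m)=\sum_{I\subseteq[m],\,|I|=m-1}\prod_{i\in I}x_i$ is the elementary symmetric polynomial of degree $m-1$, and $v_p(n)$ denotes the $p$-adic valuation of $n$ (the exponent of the largest power of $p$ dividing $n$). *)

theory Defs
  imports "HOL-Computational_Algebra.Computational_Algebra"
begin

definition elem_sym :: "nat \<Rightarrow> nat \<Rightarrow> (nat \<Rightarrow> nat) \<Rightarrow> nat" where
  "elem_sym k m x = (\<Sum>I | I \<subseteq> {1..m} \<and> card I = k. \<Prod>i\<in>I. x i)"

definition y_gcd :: "nat \<Rightarrow> (nat \<Rightarrow> nat) \<Rightarrow> nat" where
  "y_gcd m x = gcd (elem_sym (m - 1) m x) (\<Prod>i\<in>{1..m}. x i)"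

text \<open>For \<open>m = 1\<close> this is the maximum of the empty set, hence unspecified; it is only meant to be
  used at primes dividing some \<open>x i\<close> with \<open>i \<in> {1..m - 1}\<close>, of which there are then none.\<close>

definition V_max :: "nat \<Rightarrow> (nat \<Rightarrow> nat) \<Rightarrow> nat \<Rightarrow> nat" where
  "V_max m x p = Max ((\<lambda>i. multiplicity p (x i)) ` {1..m - 1})"

end

theory Submission
  imports Defs
begin

text \<open>
  Write \<open>P = x\<^sub>1 \<cdots> x\<^sub>m\<^sub>-\<^sub>1\<close> and \<open>S = \<sigma>\<^sub>m\<^sub>-\<^sub>2(x\<^sub>1, \<dots>, x\<^sub>m\<^sub>-\<^sub>1)\<close>, so that
  \<open>y = gcd (P + x\<^sub>m S) (P x\<^sub>m)\<close>. If \<open>w = v\<^sub>p(P)\<close> and \<open>T\<^sub>p\<close> is the sum in (c), then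
  \<open>S = p\<^bsup>w - V\<^esup> T\<^sub>p\<close>. If \<open>p\<close> divides \<open>T\<^sub>p\<close>, then \<open>p\<^bsup>w - V + 1\<^esup>\<close> always divides \<open>y\<close>, and
  \<open>p\<^bsup>w + V\<^esup>\<close> never does. Conversely, if no \<open>p\<close> divides \<open>T\<^sub>p\<close>, then \<open>x\<^sub>m = 1\<close> gives (a). For (b),
  let \<open>L\<close> be the least common multiple of the \<open>x\<^sub>i\<close>; then \<open>L S = P R\<close> with \<open>R\<close> coprime to
  \<open>P\<close>, and \<open>x\<^sub>m = L z\<close> works for any odd \<open>z\<close> with \<open>z R \<equiv> -1\<close> modulo \<open>P\<close>.
\<close>

section \<open>Cofactor sums and the dependence of y on the last variable\<close>

text \<open>The elementary symmetric polynomial of degree \<open>card I - 1\<close>, indexed by the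
  omitted element. It is 0 for empty \<open>I\<close>, so the recursion in
  \<open>cofactor_sum_insert\<close> has no exception and m = 1 is no special case.\<close>

definition cofactor_sum :: "('a \<Rightarrow> nat) \<Rightarrow> 'a set \<Rightarrow> nat" where
  "cofactor_sum x I = (\<Sum>i\<in>I. \<Prod>j\<in>I - {i}. x j)"

lemma elem_sym_eq_cofactor_sum:
  assumes "m \<ge> 1"
  shows "elem_sym (m - 1) m x = cofactor_sum x {1..m}"
proof -
  let ?f = "\<lambda>i. {1..m} - {i}"
  have inj: "inj_on ?f {1..m}"
    by (auto simp: inj_on_def)
  have "{I. I \<subseteq> {1..m} \<and> card I = m - 1} = ?f ` {1..m}"
  proof (intro equalityI subsetI)
    fix I assume "I \<in> {I. I \<subseteq> {1..m} \<and> card I = m - 1}"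
    hence I: "I \<subseteq> {1..m}" "card I = m - 1" by auto
    hence "card ({1..m} - I) = 1"
      using assms by (subst card_Diff_subset) (auto intro: finite_subset)
    then obtain i where i: "{1..m} - I = {i}"
      by (auto simp: card_1_singleton_iff)
    hence "i \<in> {1..m}" "I = ?f i" using I by auto
    thus "I \<in> ?f ` {1..m}" by blast
  qed auto
  thus ?thesis
    by (simp only: elem_sym_def cofactor_sum_def sum.reindex[OF inj] o_def)
qed

lemma cofactor_sum_insert:
  assumes "finite I" "k \<notin> I"
  shows "cofactor_sum x (insert k I) = prod x I + x k * cofactor_sum x I"
proof -
  have "(\<Prod>j\<in>insert k I - {i}. x j) = x k * (\<Prod>j\<in>I - {i}. x j)" if "i \<in> I" for i
  proof -
    have "insert k I - {i} = insert k (I - {i})" using that assms by auto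
    thus ?thesis using assms by simp
  qed
  thus ?thesis
    using assms by (simp add: cofactor_sum_def sum_distrib_left)
qed

text \<open>Isolates the last variable \<open>z\<close>: from here on, y depends on the other
  variables only through their product and their cofactor sum.\<close>

lemma y_gcd_update:
  assumes "m \<ge> 1"
  shows "y_gcd m (x(m := z)) =
    gcd (prod x {1..m - 1} + z * cofactor_sum x {1..m - 1}) (prod x {1..m - 1} * z)"
proof -
  have ins: "{1..m} = insert m {1..m - 1}" and m: "m \<notin> {1..m - 1}"
    using assms by auto
  have p: "prod (x(m := z)) {1..m - 1} = prod x {1..m - 1}"
    using m by (intro prod.cong) auto
  have c: "cofactor_sum (x(m := z)) {1..m - 1} = cofactor_sum x {1..m - 1}"
    unfolding cofactor_sum_def using m by (intro sum.cong prod.cong) auto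
  have "cofactor_sum (x(m := z)) {1..m} = prod x {1..m - 1} + z * cofactor_sum x {1..m - 1}"
    using cofactor_sum_insert[OF finite_atLeastAtMost m, of "x(m := z)"]
    by (simp only: ins p c fun_upd_same)
  moreover have "prod (x(m := z)) {1..m} = prod x {1..m - 1} * z"
    using prod.insert[OF finite_atLeastAtMost m, of "x(m := z)"]
    by (simp only: ins p fun_upd_same mult.commute)
  ultimately show ?thesis
    unfolding y_gcd_def elem_sym_eq_cofactor_sum[OF assms] by simp
qed

section \<open>Common denominators and prime powers in cofactor sums\<close>

lemma multiplicity_Lcm_image:
  fixes x :: "'a \<Rightarrow> nat"
  assumes "finite I" "I \<noteq> {}" "\<And>i. i \<in> I \<Longrightarrow> x i \<noteq> 0" "prime p"
  shows "multiplicity p (Lcm (x ` I)) = Max ((\<lambda>i. multiplicity p (x i)) ` I)"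
  using assms
proof (induction rule: finite_ne_induct)
  case (insert i I)
  have "0 \<notin> x ` I" using insert.prems(1) by (metis imageE insertI2)
  hence "Lcm (x ` I) \<noteq> 0" using insert.hyps by (simp add: Lcm_0_iff)
  thus ?case using insert by (simp add: multiplicity_lcm)
qed simp

text \<open>For nonzero \<open>x i\<close>, the cofactor sum is the product times the sum of the
  reciprocals \<open>1 / x i\<close>; the least common multiple clears the denominators.\<close>

lemma Lcm_times_cofactor_sum:
  assumes "finite I"
  shows "Lcm (x ` I) * cofactor_sum x I = prod x I * (\<Sum>i\<in>I. Lcm (x ` I) div x i)"
  unfolding cofactor_sum_def sum_distrib_left
proof (rule sum.cong)
  fix i assume i: "i \<in> I"
  have "Lcm (x ` I) = x i * (Lcm (x ` I) div x i)"
    using i by (simp add: dvd_Lcm)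
  moreover have "prod x I = x i * prod x (I - {i})"
    using assms i by (rule prod.remove)
  ultimately show "Lcm (x ` I) * prod x (I - {i}) = prod x I * (Lcm (x ` I) div x i)"
    by (metis mult.assoc mult.commute)
qed simp

lemma cofactor_sum_pos:
  assumes "finite I" "I \<noteq> {}" "\<And>i. i \<in> I \<Longrightarrow> x i \<noteq> 0"
  shows "cofactor_sum x I > 0"
  unfolding cofactor_sum_def using assms by (intro sum_pos prod_pos) auto

text \<open>With w the valuation of the product, the product omitting \<open>i\<close> has valuation
  w - v_p(x_i) = (w - V) + (V - v_p(x_i)). The first summand is the common factor; the bounds on
  \<open>V\<close> keep both subtractions from truncating.\<close>

lemma cofactor_sum_eq_prime_power_times:
  fixes x :: "'a \<Rightarrow> nat"
  assumes fin: "finite I" and nz: "\<And>i. i \<in> I \<Longrightarrow> x i \<noteq> 0" and p: "prime p"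
    and V: "\<And>i. i \<in> I \<Longrightarrow> multiplicity p (x i) \<le> V" and le: "V \<le> multiplicity p (prod x I)"
  shows "cofactor_sum x I = p ^ (multiplicity p (prod x I) - V) *
    (\<Sum>i\<in>I. p ^ (V - multiplicity p (x i)) * (\<Prod>j\<in>I - {i}. x j div p ^ multiplicity p (x j)))"
  unfolding cofactor_sum_def sum_distrib_left
proof (rule sum.cong)
  fix i assume i: "i \<in> I"
  let ?v = "\<lambda>j. multiplicity p (x j)"
  have "multiplicity p (prod x I) = (\<Sum>j\<in>I. ?v j)"
    using fin p by (intro prime_elem_multiplicity_prod_distrib) (auto dest: nz)
  also have "\<dots> = ?v i + (\<Sum>j\<in>I - {i}. ?v j)"
    using fin i by (rule sum.remove)
  finally have e: "(\<Sum>j\<in>I - {i}. ?v j) = (multiplicity p (prod x I) - V) + (V - ?v i)"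
    using V[OF i] le by simp
  have "(\<Prod>j\<in>I - {i}. x j) = (\<Prod>j\<in>I - {i}. p ^ ?v j * (x j div p ^ ?v j))"
    by (intro prod.cong) (simp_all add: multiplicity_dvd)
  also have "\<dots> = p ^ (\<Sum>j\<in>I - {i}. ?v j) * (\<Prod>j\<in>I - {i}. x j div p ^ ?v j)"
    by (simp add: prod.distrib power_sum)
  finally show "(\<Prod>j\<in>I - {i}. x j) = p ^ (multiplicity p (prod x I) - V) *
      (p ^ (V - ?v i) * (\<Prod>j\<in>I - {i}. x j div p ^ ?v j))"
    by (simp only: e power_add mult.assoc)
qed simp

section \<open>The valuation of y at a single prime\<close>

lemma multiplicity_gcd_low_imp_not_dvd:
  fixes P S T V p z :: nat
  assumes p: "prime p" and P: "P > 0" and z: "z > 0" and V: "V > 0" "V \<le> multiplicity p P"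
    and S: "S = p ^ (multiplicity p P - V) * T"
    and mult: "multiplicity p (gcd (P + z * S) (P * z)) = multiplicity p P - V"
  shows "\<not> p dvd T"
proof
  let ?e = "Suc (multiplicity p P - V)"
  assume "p dvd T"
  hence "p ^ ?e dvd S" unfolding S power_Suc2 by (intro mult_dvd_mono) auto
  \<comment> \<open>Since \<open>0 < V\<close> and \<open>V\<close> is at most the valuation of
    \<open>P\<close>, the exponent \<open>?e\<close> does not exceed that valuation.\<close>
  moreover have "p ^ ?e dvd P" using V by (intro multiplicity_dvd') simp
  ultimately have "p ^ ?e dvd gcd (P + z * S) (P * z)" by simp
  hence "?e \<le> multiplicity p (gcd (P + z * S) (P * z))"
    using p P z by (intro multiplicity_geI) (auto simp: prime_nat_iff)
  thus False using mult by simp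
qed

text \<open>For last variable 1 the gcd reduces to \<open>gcd S P\<close>, and \<open>S\<close> has
  the smaller valuation.\<close>

lemma multiplicity_gcd_low:
  fixes P S T V p :: nat
  assumes p: "prime p" and P: "P > 0" and S: "S = p ^ (multiplicity p P - V) * T"
    and T: "\<not> p dvd T"
  shows "multiplicity p (gcd (P + S) P) = multiplicity p P - V"
proof -
  have "multiplicity p S = multiplicity p P - V"
    using T p unfolding S by (intro multiplicity_decomposeI[OF refl]) (auto simp: prime_nat_iff)
  moreover have "S \<noteq> 0" using S T p by (auto intro: gr0I)
  ultimately have "multiplicity p (gcd S P) = multiplicity p P - V"
    using P p by (subst multiplicity_gcd) auto
  thus ?thesis by (metis gcd.commute gcd_add1 add.commute)
qed

text \<open>Divisibility of \<open>P * z\<close> forces p^V to divide \<open>z\<close>. If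
  \<open>p\<close> also divided \<open>T\<close>, then \<open>z * S\<close> would be divisible by
  p^(w+1), with w the valuation of \<open>P\<close>; so would \<open>P + z * S\<close>, as
  \<open>V > 0\<close>, and hence \<open>P\<close> itself.\<close>

lemma multiplicity_gcd_high_imp_not_dvd:
  fixes P S T V p z :: nat
  assumes p: "prime p" and P: "P > 0" and z: "z > 0" and V: "V > 0" "V \<le> multiplicity p P"
    and S: "S = p ^ (multiplicity p P - V) * T"
    and mult: "multiplicity p (gcd (P + z * S) (P * z)) = multiplicity p P + V"
  shows "\<not> p dvd T"
proof
  let ?w = "multiplicity p P"
  assume T: "p dvd T"
  have dvd: "p ^ (?w + V) dvd gcd (P + z * S) (P * z)"
    using mult by (metis multiplicity_dvd)
  hence "p ^ (?w + V) dvd P * z" by simp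
  hence "?w + V \<le> multiplicity p (P * z)"
    using p P z by (intro multiplicity_geI) (auto simp: prime_nat_iff)
  also have "\<dots> = ?w + multiplicity p z"
    using p P z by (intro prime_elem_multiplicity_mult_distrib) auto
  finally have "p ^ V dvd z" by (intro multiplicity_dvd') simp
  moreover have "p ^ Suc (?w - V) dvd S"
    using T unfolding S power_Suc2 by (intro mult_dvd_mono) auto
  ultimately have "p ^ V * p ^ Suc (?w - V) dvd z * S" by (rule mult_dvd_mono)
  moreover have "p ^ V * p ^ Suc (?w - V) = p ^ Suc ?w"
    unfolding power_add[symmetric] using V by simp
  moreover have "p ^ Suc ?w dvd P + z * S"
  proof (rule dvd_trans)
    show "p ^ Suc ?w dvd p ^ (?w + V)" using V by (intro le_imp_power_dvd) simp
    show "p ^ (?w + V) dvd P + z * S" using dvd by simp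
  qed
  ultimately have "p ^ Suc ?w dvd P"
    by (metis dvd_add_left_iff)
  hence "Suc ?w \<le> ?w" using p P by (intro multiplicity_geI) (auto simp: prime_nat_iff)
  thus False by simp
qed

section \<open>Construction of the last variable for (b)\<close>

lemma odd_solution_minus_one:
  fixes P R :: nat
  assumes "coprime P R" "odd P"
  obtains z where "odd z" "P dvd 1 + z * R"
proof -
  have "P \<noteq> 0" using assms by (auto intro: gr0I)
  then obtain a b where "P * a = R * b + gcd P R"
    using bezout_nat by blast
  hence b: "P dvd 1 + b * R"
    using assms by (metis coprime_imp_gcd_eq_1 add.commute dvd_triv_left mult.commute)
  show ?thesis
  proof (cases "odd b")
    case True
    thus ?thesis using b that by blast
  next
    case False
    \<comment> \<open>Adding the odd modulus \<open>P\<close> flips the parity of \<open>b\<close>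
      and keeps its residue.\<close>
    have "1 + (b + P) * R = (1 + b * R) + P * R" by (simp add: algebra_simps)
    hence "P dvd 1 + (b + P) * R" using b by (metis dvd_add dvd_triv_left)
    thus ?thesis using False assms that[of "b + P"] by simp
  qed
qed

text \<open>For last variable \<open>L * z\<close> the first argument of the gcd becomes
  \<open>P * (1 + z * R)\<close>, a multiple of \<open>P * L\<close> because \<open>L\<close>
  divides \<open>P\<close>. The second, \<open>P * L * z\<close>, determines the valuation, as
  \<open>p\<close> does not divide \<open>z\<close>.\<close>

lemma exists_gcd_high:
  fixes P S L R :: nat
  assumes P: "odd P" and L: "odd L" and R: "L * S = P * R" and coprime: "coprime P R"
    and dvd: "L dvd P"
  obtains z where "odd z"
    "\<And>p. prime p \<Longrightarrow> p dvd P \<Longrightarrow>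
       multiplicity p (gcd (P + z * S) (P * z)) = multiplicity p P + multiplicity p L"
proof -
  obtain z where z: "odd z" "P dvd 1 + z * R"
    using odd_solution_minus_one[OF coprime P] .
  have nz: "P \<noteq> 0" "L \<noteq> 0" "z \<noteq> 0" "1 + z * R \<noteq> 0"
    using P L z by (auto intro: gr0I)
  show ?thesis
  proof (rule that)
    show "odd (L * z)" using L z by simp
  next
    fix p assume p: "prime p" "p dvd P"
    have "\<not> p dvd z"
    proof
      assume "p dvd z"
      moreover have "p dvd 1 + z * R" using p z dvd_trans by blast
      ultimately have "p dvd 1" by (metis dvd_add_left_iff dvd_mult2)
      thus False using p by simp
    qed
    hence mz: "multiplicity p z = 0" by (rule not_dvd_imp_multiplicity_0)
    have "L dvd 1 + z * R" using dvd z dvd_trans by blast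
    hence mL: "multiplicity p L \<le> multiplicity p (1 + z * R)"
      using nz by (intro dvd_imp_multiplicity_le) auto
    have "P + (L * z) * S = P * (1 + z * R)"
      using R by (simp add: algebra_simps)
    hence "multiplicity p (gcd (P + (L * z) * S) (P * (L * z)))
        = min (multiplicity p (P * (1 + z * R))) (multiplicity p (P * (L * z)))"
      using nz p(1) by (simp only:) (subst multiplicity_gcd; simp)
    also have "\<dots> = multiplicity p P + multiplicity p L"
      using p(1) nz mz mL
      by (simp add: prime_elem_multiplicity_mult_distrib del: mult_Suc_right)
    finally show "multiplicity p (gcd (P + (L * z) * S) (P * (L * z)))
        = multiplicity p P + multiplicity p L" .
  qed
qed

section \<open>The equivalence: (a) and (b) each imply (c), and (c) implies both\<close>

theorem theorem4p10:
  fixes m :: nat and x :: "nat \<Rightarrow> nat"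
  assumes "m \<ge> 1"
    and "\<And>i. i \<in> {1..m - 1} \<Longrightarrow> 0 < x i \<and> odd (x i)"
  defines "A \<equiv> (\<exists>xm::nat. 0 < xm \<and> odd xm \<and>
             (\<forall>p. prime p \<and> (\<exists>i\<in>{1..m - 1}. p dvd x i) \<longrightarrow>
                multiplicity p (y_gcd m (x(m := xm)))
                  = multiplicity p (\<Prod>i\<in>{1..m - 1}. x i) - V_max m x p))"
    and "B \<equiv> (\<exists>xm::nat. 0 < xm \<and> odd xm \<and>
             (\<forall>p. prime p \<and> (\<exists>i\<in>{1..m - 1}. p dvd x i) \<longrightarrow>
                multiplicity p (y_gcd m (x(m := xm)))
                  = multiplicity p (\<Prod>i\<in>{1..m - 1}. x i) + V_max m x p))"
    and "C \<equiv> (\<forall>p. prime p \<and> (\<exists>i\<in>{1..m - 1}. p dvd x i) \<longrightarrow>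
             \<not> p dvd (\<Sum>i\<in>{1..m - 1}. p ^ (V_max m x p - multiplicity p (x i)) *
                        (\<Prod>j\<in>{1..m - 1} - {i}. x j div p ^ multiplicity p (x j))))"
  shows "(A \<longleftrightarrow> B) \<and> (B \<longleftrightarrow> C)"
proof -
  define I where "I = {1..m - 1}"
  define P where "P = prod x I"
  define S where "S = cofactor_sum x I"
  define T where "T p = (\<Sum>i\<in>I. p ^ (V_max m x p - multiplicity p (x i)) *
    (\<Prod>j\<in>I - {i}. x j div p ^ multiplicity p (x j)))" for p
  have fin: "finite I" and odd_x: "\<And>i. i \<in> I \<Longrightarrow> odd (x i)" and nz: "\<And>i. i \<in> I \<Longrightarrow> x i \<noteq> 0"
    using assms(2) by (auto simp: I_def)
  have odd_P: "odd P" and P: "P > 0"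
    using fin odd_x nz by (auto simp: P_def even_prod_iff intro: gr0I)
  have prime_dvd: "(\<exists>i\<in>I. p dvd x i) \<longleftrightarrow> p dvd P" if "prime p" for p
    using that fin by (simp add: P_def prime_dvd_prod_iff)
  have y: "y_gcd m (x(m := z)) = gcd (P + z * S) (P * z)" for z
    using y_gcd_update[OF assms(1)] by (simp add: P_def S_def I_def)
  have le_V: "multiplicity p (x i) \<le> V_max m x p" if "i \<in> I" for p i
    using that unfolding V_max_def I_def[symmetric] by (intro Max_ge) (use fin in auto)
  \<comment> \<open>Nonemptiness is essential: \<open>Max\<close> of the empty set is
    unspecified.\<close>
  have V_attained: "\<exists>i\<in>I. V_max m x p = multiplicity p (x i)" if "I \<noteq> {}" for p
  proof -
    have "V_max m x p \<in> (\<lambda>i. multiplicity p (x i)) ` I"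
      unfolding V_max_def I_def[symmetric] using fin that by (intro Max_in) auto
    thus ?thesis by blast
  qed
  \<comment> \<open>The input of the single-prime lemmas: \<open>V_max m x p\<close> is positive
    because \<open>p\<close> divides some \<open>x i\<close>, and bounded because it is attained at
    some \<open>x k\<close>, a divisor of \<open>P\<close>.\<close>
  have local_facts: "V_max m x p > 0 \<and> V_max m x p \<le> multiplicity p P \<and>
      S = p ^ (multiplicity p P - V_max m x p) * T p" if p: "prime p" "p dvd P" for p
  proof -
    obtain i where i: "i \<in> I" "p dvd x i" using p prime_dvd by blast
    have "0 < multiplicity p (x i)"
      using i nz p by (simp add: prime_multiplicity_gt_zero_iff)
    hence pos: "V_max m x p > 0" using le_V[OF i(1), of p] by simp
    obtain k where k: "k \<in> I" "V_max m x p = multiplicity p (x k)"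
      using V_attained i by blast
    have le: "V_max m x p \<le> multiplicity p P"
      unfolding k(2) using k(1) fin P by (intro dvd_imp_multiplicity_le) (auto simp: P_def)
    show ?thesis
      using pos le cofactor_sum_eq_prime_power_times[OF fin nz p(1) le_V]
      by (simp add: S_def T_def P_def)
  qed
  have C: "C \<longleftrightarrow> (\<forall>p. prime p \<and> p dvd P \<longrightarrow> \<not> p dvd T p)"
    unfolding C_def T_def I_def[symmetric] using prime_dvd by blast
  have A: "A \<longleftrightarrow> (\<exists>z. 0 < z \<and> odd z \<and> (\<forall>p. prime p \<and> p dvd P \<longrightarrow>
      multiplicity p (gcd (P + z * S) (P * z)) = multiplicity p P - V_max m x p))"
    unfolding A_def y I_def[symmetric] P_def[symmetric] using prime_dvd by metis
  have B: "B \<longleftrightarrow> (\<exists>z. 0 < z \<and> odd z \<and> (\<forall>p. prime p \<and> p dvd P \<longrightarrow>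
      multiplicity p (gcd (P + z * S) (P * z)) = multiplicity p P + V_max m x p))"
    unfolding B_def y I_def[symmetric] P_def[symmetric] using prime_dvd by metis
  have "C" if "A"
    unfolding C
  proof (intro allI impI)
    fix p assume p: "prime p \<and> p dvd P"
    from \<open>A\<close> p obtain z where "0 < z"
      "multiplicity p (gcd (P + z * S) (P * z)) = multiplicity p P - V_max m x p"
      unfolding A by blast
    thus "\<not> p dvd T p"
      using p P local_facts[of p] multiplicity_gcd_low_imp_not_dvd by blast
  qed
  moreover have "C" if "B"
    unfolding C
  proof (intro allI impI)
    fix p assume p: "prime p \<and> p dvd P"
    from \<open>B\<close> p obtain z where "0 < z"
      "multiplicity p (gcd (P + z * S) (P * z)) = multiplicity p P + V_max m x p"
      unfolding B by blast
    thus "\<not> p dvd T p"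
      using p P local_facts[of p] multiplicity_gcd_high_imp_not_dvd by blast
  qed
  moreover have "A" if "C"
    unfolding A
  proof (intro exI conjI allI impI)
    fix p assume p: "prime p \<and> p dvd P"
    hence "\<not> p dvd T p" using \<open>C\<close> unfolding C by blast
    \<comment> \<open>The explicit factors 1 fix the witness of the existential statement, the same
      for all primes.\<close>
    thus "multiplicity p (gcd (P + 1 * S) (P * 1)) = multiplicity p P - V_max m x p"
      using p P local_facts[of p] multiplicity_gcd_low by simp
  qed auto
  moreover have "B" if "C"
  proof -
    define L where "L = Lcm (x ` I)"
    define R where "R = (\<Sum>i\<in>I. L div x i)"
    have LS: "L * S = P * R"
      unfolding L_def S_def P_def R_def using fin by (rule Lcm_times_cofactor_sum)
    have "L dvd P"
      unfolding L_def P_def using fin by (auto intro!: Lcm_least)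
    hence "odd L" using odd_P dvd_trans by blast
    hence "L > 0" by (auto intro: gr0I)
    \<comment> \<open>\<open>L\<close> has the valuation prescribed in (b) at all primes dividing
      \<open>P\<close> at once, so no separate congruence for each prime is required.\<close>
    have mult_L: "multiplicity p L = V_max m x p" if "prime p" "p dvd P" for p
      unfolding L_def V_max_def I_def[symmetric]
      using fin nz that prime_dvd by (intro multiplicity_Lcm_image) auto
    \<comment> \<open>At a common prime divisor, compare valuations in \<open>L * S = P * R\<close>.
      By (c) the left side has V + (w - V) = w, where w is the valuation of \<open>P\<close>; the
      right side has more than w.\<close>
    have "coprime P R"
    proof (rule ccontr)
      assume "\<not> coprime P R"
      hence "gcd P R \<noteq> 1" by (simp add: coprime_iff_gcd_eq_1)
      then obtain p where p: "prime p" "p dvd P" "p dvd R"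
        using prime_factor_nat by (metis gcd_greatest_iff)
      note loc = local_facts[OF p(1,2)]
      have "I \<noteq> {}" using p prime_dvd by blast
      hence S: "S > 0" unfolding S_def using fin nz by (intro cofactor_sum_pos) auto
      have "R > 0" using LS \<open>L > 0\<close> S by (auto intro: gr0I)
      have "\<not> p dvd T p" using \<open>C\<close> p unfolding C by blast
      hence "multiplicity p S = multiplicity p P - V_max m x p"
        using loc p by (intro multiplicity_decomposeI) (auto simp: prime_nat_iff)
      hence "multiplicity p (L * S) = multiplicity p P"
        using loc p S \<open>L > 0\<close> mult_L[OF p(1,2)]
        by (simp add: prime_elem_multiplicity_mult_distrib)
      moreover have "multiplicity p (P * R) = multiplicity p P + multiplicity p R"
        using p P \<open>R > 0\<close> by (intro prime_elem_multiplicity_mult_distrib) auto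
      moreover have "multiplicity p R > 0"
        using p \<open>R > 0\<close> by (simp add: prime_multiplicity_gt_zero_iff)
      ultimately show False using LS by simp
    qed
    then obtain z where "odd z" "\<And>p. prime p \<Longrightarrow> p dvd P \<Longrightarrow>
        multiplicity p (gcd (P + z * S) (P * z)) = multiplicity p P + multiplicity p L"
      using exists_gcd_high[OF odd_P \<open>odd L\<close> LS _ \<open>L dvd P\<close>] by blast
    thus ?thesis
      unfolding B using mult_L by (intro exI[of _ z]) (auto intro: gr0I)
  qed
  ultimately show ?thesis by blast
qed

end
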